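(* Let $\mathfrak{g}$ be a finite-dimensional complex non-abelian Lie algebra. The $2$-cocycle $c$ on $\mathfrak{g}\rtimes\mathfrak{g}$ with values in the adjoint representation of $\mathfrak{g}\rtimes\mathfrak{g}$, given by $c((m,g),(m',g'))=(0,[m,m'])$, is not cohomologous to zero, i.e. it is not a Chevalley-Eilenberg coboundary.
   Context: The semi-direct product $\mathfrak{g}\rtimes\mathfrak{g}$ is the vector space $\mathfrak{g}\oplus\mathfrak{g}$ with bracket $[(m,g),(m',g')]=([g,m']-[g',m],[g,g'])$; that is, the first factor is viewed as the adjoint $\mathfrak{g}$-module and as an abelian Lie algebra. Cochains are those of the Chevalley-Eilenberg complex of $\mathfrak{g}\rtimes\mathfrak{g}$ with coefficients in itself (adjoint representation). *)

theory Defs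
  imports "HOL-Analysis.Product_Vector"
begin

section \<open>Lie algebras and their representations\<close>

locale lie_algebra = vector_space scale
  for scale :: "'k::field \<Rightarrow> 'l::ab_group_add \<Rightarrow> 'l" +
  fixes bracket :: "'l \<Rightarrow> 'l \<Rightarrow> 'l"
  assumes linear_bracket_left: "\<And>y. Vector_Spaces.linear scale scale (\<lambda>x. bracket x y)"
    and linear_bracket_right: "\<And>x. Vector_Spaces.linear scale scale (\<lambda>y. bracket x y)"
    and bracket_self: "\<And>x. bracket x x = 0"
    and jacobi: "\<And>x y z.
      bracket x (bracket y z) + bracket y (bracket z x) + bracket z (bracket x y) = 0"

definition lie_abelian :: "('l \<Rightarrow> 'l \<Rightarrow> 'l::zero) \<Rightarrow> bool"
  where "lie_abelian bracket \<longleftrightarrow> (\<forall>x y. bracket x y = 0)"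

locale lie_representation = L: lie_algebra scale bracket + V: vector_space scaleV
  for scale :: "'k::field \<Rightarrow> 'l::ab_group_add \<Rightarrow> 'l"
    and bracket :: "'l \<Rightarrow> 'l \<Rightarrow> 'l"
    and scaleV :: "'k \<Rightarrow> 'v::ab_group_add \<Rightarrow> 'v" +
  fixes act :: "'l \<Rightarrow> 'v \<Rightarrow> 'v"
  assumes linear_act_left: "\<And>v. Vector_Spaces.linear scale scaleV (\<lambda>x. act x v)"
    and linear_act_right: "\<And>x. Vector_Spaces.linear scaleV scaleV (act x)"
    and act_bracket: "\<And>x y v. act (bracket x y) v = act x (act y v) - act y (act x v)"

context lie_algebra
begin

lemma bracket_add_left: "bracket (x + y) z = bracket x z + bracket y z"
  using linear_bracket_left[of z] by (simp add: Vector_Spaces.linear_iff)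

lemma bracket_add_right: "bracket z (x + y) = bracket z x + bracket z y"
  using linear_bracket_right[of z] by (simp add: Vector_Spaces.linear_iff)

lemma bracket_scale_left: "bracket (scale a x) y = scale a (bracket x y)"
  using linear_bracket_left[of y] by (simp add: Vector_Spaces.linear_iff)

lemma bracket_scale_right: "bracket x (scale a y) = scale a (bracket x y)"
  using linear_bracket_right[of x] by (simp add: Vector_Spaces.linear_iff)

lemma bracket_zero_left [simp]: "bracket 0 x = 0"
  using bracket_add_left[of 0 0 x] by simp

lemma bracket_zero_right [simp]: "bracket x 0 = 0"
  using bracket_add_right[of x 0 0] by simp

lemma bracket_minus_left: "bracket (- x) y = - bracket x y"
  using bracket_add_left[of x "- x" y] by (simp add: eq_neg_iff_add_eq_0 add.commute)

lemma bracket_minus_right: "bracket x (- y) = - bracket x y"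
  using bracket_add_right[of x y "- y"] by (simp add: eq_neg_iff_add_eq_0 add.commute)

lemma bracket_diff_left: "bracket (x - y) z = bracket x z - bracket y z"
  using bracket_add_left[of x "- y" z] by (simp add: bracket_minus_left)

lemma bracket_diff_right: "bracket z (x - y) = bracket z x - bracket z y"
  using bracket_add_right[of z x "- y"] by (simp add: bracket_minus_right)

lemma bracket_antisym: "bracket x y = - bracket y x"
proof -
  have "bracket x y + bracket y x = bracket (x + y) (x + y)"
    by (simp add: bracket_add_left bracket_add_right) (simp add: bracket_self)
  then have "bracket x y + bracket y x = 0"
    by (simp only: bracket_self)
  then show ?thesis by (simp add: eq_neg_iff_add_eq_0)
qed

lemma bracket_bracket:
  "bracket (bracket x y) z = bracket x (bracket y z) - bracket y (bracket x z)"
proof -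
  have "bracket y (bracket z x) = - bracket y (bracket x z)"
    using bracket_antisym[of z x] by (simp add: bracket_minus_right)
  moreover have "bracket z (bracket x y) = - bracket (bracket x y) z"
    by (rule bracket_antisym)
  ultimately show ?thesis using jacobi[of x y z] by (simp add: algebra_simps)
qed

lemma adjoint_representation: "lie_representation scale bracket scale bracket"
  unfolding lie_representation_def lie_representation_axioms_def
  using lie_algebra_axioms vector_space_axioms linear_bracket_left linear_bracket_right
    bracket_bracket
  by blast

end


section \<open>The Chevalley-Eilenberg complex\<close>

text \<open>
  An \<open>n\<close>-cochain is an alternating multilinear map in \<open>n\<close> arguments, encoded as a function on
  argument lists of which only the values on lists of length \<open>n\<close> matter.
\<close>

definition ce_cochain ::
  "('k::field \<Rightarrow> 'l::ab_group_add \<Rightarrow> 'l) \<Rightarrow> ('k \<Rightarrow> 'v::ab_group_add \<Rightarrow> 'v) \<Rightarrow> nat \<Rightarrow>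
   ('l list \<Rightarrow> 'v) \<Rightarrow> bool"
  where "ce_cochain sL sV n f \<longleftrightarrow>
    (\<forall>xs i. length xs = n \<longrightarrow> i < n \<longrightarrow>
       Vector_Spaces.linear sL sV (\<lambda>x. f (xs[i := x]))) \<and>
    (\<forall>xs i j. length xs = n \<longrightarrow> i < j \<longrightarrow> j < n \<longrightarrow> xs ! i = xs ! j \<longrightarrow> f xs = 0)"

definition omit_nth :: "nat \<Rightarrow> 'a list \<Rightarrow> 'a list"
  where "omit_nth i xs = take i xs @ drop (Suc i) xs"

text \<open>
  \<open>(d f)(x\<^sub>0, \<dots>, x\<^sub>n) = \<Sum>\<^sub>i (-1)\<^sup>i x\<^sub>i \<cdot> f(\<dots>, omit x\<^sub>i, \<dots>)
     + \<Sum>\<^sub>i\<^sub><\<^sub>j (-1)\<^sup>i\<^sup>+\<^sup>j f([x\<^sub>i, x\<^sub>j], \<dots>, omit x\<^sub>i, \<dots>, omit x\<^sub>j, \<dots>)\<close>,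
  with arguments numbered from \<open>0\<close>.
\<close>

definition ce_differential ::
  "('l \<Rightarrow> 'l \<Rightarrow> 'l) \<Rightarrow> ('k::field \<Rightarrow> 'v::ab_group_add \<Rightarrow> 'v) \<Rightarrow> ('l \<Rightarrow> 'v \<Rightarrow> 'v) \<Rightarrow>
   ('l list \<Rightarrow> 'v) \<Rightarrow> 'l list \<Rightarrow> 'v"
  where "ce_differential bracket sV act f xs =
    (\<Sum>i<length xs. sV ((-1) ^ i) (act (xs ! i) (f (omit_nth i xs)))) +
    (\<Sum>j<length xs. \<Sum>i<j. sV ((-1) ^ (i + j))
       (f (bracket (xs ! i) (xs ! j) # omit_nth i (omit_nth j xs))))"

definition ce_cocycle ::
  "('k::field \<Rightarrow> 'l::ab_group_add \<Rightarrow> 'l) \<Rightarrow> ('l \<Rightarrow> 'l \<Rightarrow> 'l) \<Rightarrow>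
   ('k \<Rightarrow> 'v::ab_group_add \<Rightarrow> 'v) \<Rightarrow> ('l \<Rightarrow> 'v \<Rightarrow> 'v) \<Rightarrow> nat \<Rightarrow> ('l list \<Rightarrow> 'v) \<Rightarrow> bool"
  where "ce_cocycle sL bracket sV act n f \<longleftrightarrow>
    ce_cochain sL sV n f \<and>
    (\<forall>xs. length xs = Suc n \<longrightarrow> ce_differential bracket sV act f xs = 0)"

fun ce_coboundary ::
  "('k::field \<Rightarrow> 'l::ab_group_add \<Rightarrow> 'l) \<Rightarrow> ('l \<Rightarrow> 'l \<Rightarrow> 'l) \<Rightarrow>
   ('k \<Rightarrow> 'v::ab_group_add \<Rightarrow> 'v) \<Rightarrow> ('l \<Rightarrow> 'v \<Rightarrow> 'v) \<Rightarrow> nat \<Rightarrow> ('l list \<Rightarrow> 'v) \<Rightarrow> bool"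
  where
    "ce_coboundary sL bracket sV act 0 f \<longleftrightarrow> f [] = 0"
  | "ce_coboundary sL bracket sV act (Suc n) f \<longleftrightarrow>
      (\<exists>h. ce_cochain sL sV n h \<and>
        (\<forall>xs. length xs = Suc n \<longrightarrow> f xs = ce_differential bracket sV act h xs))"

lemma (in vector_space) ce_differential_1:
  "ce_differential br scale act h [x, y] = act x (h [y]) - act y (h [x]) - h [br x y]"
  by (simp add: ce_differential_def omit_nth_def lessThan_Suc)

lemma (in vector_space) ce_differential_2:
  "ce_differential br scale act f [x, y, z] =
     act x (f [y, z]) - act y (f [x, z]) + act z (f [x, y])
     - f [br x y, z] + f [br x z, y] - f [br y z, x]"
  by (simp add: ce_differential_def omit_nth_def lessThan_Suc)


section \<open>The semi-direct product of a Lie algebra with its adjoint module\<close>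

definition semidirect_bracket :: "('g \<Rightarrow> 'g \<Rightarrow> 'g::ab_group_add) \<Rightarrow> 'g \<times> 'g \<Rightarrow> 'g \<times> 'g \<Rightarrow> 'g \<times> 'g"
  where "semidirect_bracket bracket = (\<lambda>(m, g) (m', g').
    (bracket g m' - bracket g' m, bracket g g'))"

abbreviation semidirect_scale ::
  "('k::field \<Rightarrow> 'g::ab_group_add \<Rightarrow> 'g) \<Rightarrow> 'k \<Rightarrow> 'g \<times> 'g \<Rightarrow> 'g \<times> 'g"
  where "semidirect_scale s \<equiv> module_prod.scale s s"

definition semidirect_cochain :: "('g \<Rightarrow> 'g \<Rightarrow> 'g::zero) \<Rightarrow> ('g \<times> 'g) list \<Rightarrow> 'g \<times> 'g"
  where "semidirect_cochain bracket xs = (0, bracket (fst (xs ! 0)) (fst (xs ! 1)))"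

lemma semidirect_cochain_pair:
  "semidirect_cochain bracket [(m, g), (m', g')] = (0, bracket m m')"
  by (simp add: semidirect_cochain_def)

lemma (in lie_algebra) lie_algebra_semidirect:
  "lie_algebra (semidirect_scale scale) (semidirect_bracket bracket)"
proof -
  interpret P: vector_space_prod scale scale by unfold_locales
  have vs: "vector_space (semidirect_scale scale)"
    by (rule P.p.vector_space_axioms)
  show ?thesis
    unfolding lie_algebra_def lie_algebra_axioms_def
  proof (intro conjI allI)
    fix x y z :: "'l \<times> 'l"
    show "vector_space (semidirect_scale scale)" by (rule vs)
    show "Vector_Spaces.linear (semidirect_scale scale) (semidirect_scale scale)
        (\<lambda>x. semidirect_bracket bracket x y)"
      by (simp add: Vector_Spaces.linear_iff vs P.scale_def semidirect_bracket_def split_beta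
          bracket_add_left bracket_add_right bracket_scale_left bracket_scale_right
          scale_right_diff_distrib)
    show "Vector_Spaces.linear (semidirect_scale scale) (semidirect_scale scale)
        (\<lambda>y. semidirect_bracket bracket x y)"
      by (simp add: Vector_Spaces.linear_iff vs P.scale_def semidirect_bracket_def split_beta
          bracket_add_left bracket_add_right bracket_scale_left bracket_scale_right
          scale_right_diff_distrib)
    show "semidirect_bracket bracket x x = 0"
      by (simp add: semidirect_bracket_def split_beta bracket_self zero_prod_def)
    obtain m g m' g' m'' g'' where [simp]: "x = (m, g)" "y = (m', g')" "z = (m'', g'')"
      by (metis surj_pair)
    show "semidirect_bracket bracket x (semidirect_bracket bracket y z) +
        semidirect_bracket bracket y (semidirect_bracket bracket z x) +
        semidirect_bracket bracket z (semidirect_bracket bracket x y) = 0"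
      using jacobi[of g g' g'']
      by (simp add: semidirect_bracket_def zero_prod_def bracket_diff_right
          bracket_bracket[of g g'] bracket_bracket[of g' g''] bracket_bracket[of g'' g])
  qed
qed

end

theory Submission
  imports Defs
begin

text \<open>
  Write \<open>M\<close> for the first factor of \<open>\<gg> \<rtimes> \<gg>\<close>, an abelian ideal. The two halves of the
  theorem have different reasons.

  The map \<open>c\<close> is a cocycle because of the Jacobi identity: in \<open>d c\<close>, the \<open>M\<close>-component is a
  Jacobi sum of the three \<open>M\<close>-parts, while the \<open>\<gg>\<close>-component says that \<open>ad g\<close> is a derivation of
  the bracket, once for each of the three \<open>\<gg>\<close>-parts.

  The map \<open>c\<close> is not a coboundary because a coboundary \<open>d h\<close> takes values in \<open>M\<close> on pairs from
  \<open>M\<close>: in \<open>d h (x, y) = [x, h y] - [y, h x] - h [x, y]\<close> the first two terms lie in \<open>M\<close>, which is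
  an ideal, and the last one vanishes, as \<open>M\<close> is abelian. But \<open>c\<close> maps \<open>M \<times> M\<close> into the
  complementary factor, by the bracket of \<open>\<gg>\<close>; so \<open>c = d h\<close> would force this bracket to be zero.
\<close>

context lie_algebra
begin

lemma ce_cochain_semidirect_cochain:
  "ce_cochain (semidirect_scale scale) (semidirect_scale scale) 2 (semidirect_cochain bracket)"
proof -
  interpret P: vector_space_prod scale scale by unfold_locales
  have vs: "vector_space (semidirect_scale scale)"
    by (rule P.p.vector_space_axioms)
  show ?thesis
    unfolding ce_cochain_def
  proof (intro conjI allI impI)
    fix xs :: "('l \<times> 'l) list" and i :: nat
    assume "length xs = 2" "i < 2"
    then consider "i = 0" | "i = 1" by linarith
    then show "Vector_Spaces.linear (semidirect_scale scale) (semidirect_scale scale)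
        (\<lambda>x. semidirect_cochain bracket (xs[i := x]))"
      using \<open>length xs = 2\<close>
      by cases (simp_all add: Vector_Spaces.linear_iff vs P.scale_def semidirect_cochain_def
          bracket_add_left bracket_add_right bracket_scale_left bracket_scale_right)
  next
    fix xs :: "('l \<times> 'l) list" and i j :: nat
    assume "i < j" "j < 2" "xs ! i = xs ! j"
    moreover from this have "i = 0" "j = 1" by linarith+
    ultimately show "semidirect_cochain bracket xs = 0"
      by (simp add: semidirect_cochain_def bracket_self zero_prod_def)
  qed
qed

lemma ce_differential_semidirect_cochain:
  "ce_differential (semidirect_bracket bracket) (semidirect_scale scale)
     (semidirect_bracket bracket) (semidirect_cochain bracket) [x, y, z] = 0"
proof -
  interpret P: vector_space_prod scale scale by unfold_locales
  obtain m g m' g' m'' g'' where [simp]: "x = (m, g)" "y = (m', g')" "z = (m'', g'')"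
    by (metis surj_pair)
  have derivation: "bracket a (bracket b c) = bracket (bracket a b) c + bracket b (bracket a c)"
    for a b c
    by (simp add: bracket_bracket)
  have M_part: "- bracket (bracket m' m'') m + bracket (bracket m m'') m'
      - bracket (bracket m m') m'' = 0"
    using bracket_antisym[of "bracket m m''" m']
    by (simp add: bracket_bracket[of m m' m''] bracket_antisym[of "bracket m' m''" m])
  have g_part: "bracket g (bracket m' m'') - bracket g' (bracket m m'') + bracket g'' (bracket m m')
      - bracket (bracket g m' - bracket g' m) m''
      + bracket (bracket g m'' - bracket g'' m) m'
      - bracket (bracket g' m'' - bracket g'' m') m = 0"
    using bracket_antisym[of "bracket g m''" m'] bracket_antisym[of "bracket g'' m" m']
      bracket_antisym[of "bracket g' m''" m] bracket_antisym[of "bracket g'' m'" m]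
    by (simp add: derivation[of g m' m''] derivation[of g' m m''] derivation[of g'' m m']
        bracket_diff_left)
  show ?thesis
    using M_part g_part
    by (simp add: P.p.ce_differential_2 semidirect_bracket_def semidirect_cochain_def zero_prod_def)
qed

lemma ce_cocycle_semidirect_cochain:
  "ce_cocycle (semidirect_scale scale) (semidirect_bracket bracket)
     (semidirect_scale scale) (semidirect_bracket bracket) 2 (semidirect_cochain bracket)"
  unfolding ce_cocycle_def
proof (intro conjI allI impI)
  fix xs :: "('l \<times> 'l) list"
  assume "length xs = Suc 2"
  then obtain x y z where "xs = [x, y, z]"
    by (auto simp: numeral_2_eq_2 length_Suc_conv)
  then show "ce_differential (semidirect_bracket bracket) (semidirect_scale scale)
      (semidirect_bracket bracket) (semidirect_cochain bracket) xs = 0"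
    by (simp add: ce_differential_semidirect_cochain)
qed (rule ce_cochain_semidirect_cochain)

text \<open>
  The first factor is an ideal, so the two action terms stay in it, and it is abelian, so that the
  remaining term is \<open>h 0\<close>, which is zero by linearity.
\<close>

lemma snd_ce_differential_on_abelian_ideal:
  assumes "ce_cochain (semidirect_scale scale) (semidirect_scale scale) 1 h"
  shows "snd (ce_differential (semidirect_bracket bracket) (semidirect_scale scale)
    (semidirect_bracket bracket) h [(m, 0), (m', 0)]) = 0"
proof -
  interpret P: vector_space_prod scale scale by unfold_locales
  have "Vector_Spaces.linear (semidirect_scale scale) (semidirect_scale scale) (\<lambda>x. h ([0][0 := x]))"
    using assms unfolding ce_cochain_def
    by (metis One_nat_def length_Cons less_one list.size(3))
  then have "h [0 + 0] = h [0] + h [0]"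
    unfolding Vector_Spaces.linear_iff list_update_code by blast
  then have "h [(0, 0)] = 0"
    by (simp add: zero_prod_def)
  then show ?thesis
    by (simp add: P.p.ce_differential_1 semidirect_bracket_def split_beta)
qed

lemma lie_abelian_if_semidirect_cochain_coboundary:
  assumes "ce_coboundary (semidirect_scale scale) (semidirect_bracket bracket)
    (semidirect_scale scale) (semidirect_bracket bracket) 2 (semidirect_cochain bracket)"
  shows "lie_abelian bracket"
  unfolding lie_abelian_def
proof (intro allI)
  fix m m'
  obtain h where h: "ce_cochain (semidirect_scale scale) (semidirect_scale scale) 1 h"
    and eq: "\<And>xs. length xs = 2 \<Longrightarrow> semidirect_cochain bracket xs =
      ce_differential (semidirect_bracket bracket) (semidirect_scale scale)
        (semidirect_bracket bracket) h xs"
    using assms by (auto simp: numeral_2_eq_2)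
  have "bracket m m' = snd (semidirect_cochain bracket [(m, 0), (m', 0)])"
    by (simp add: semidirect_cochain_pair)
  also have "\<dots> = 0"
    by (simp add: eq snd_ce_differential_on_abelian_ideal[OF h])
  finally show "bracket m m' = 0" .
qed

end

theorem proposition1p2:
  fixes scale :: "complex \<Rightarrow> 'g::ab_group_add \<Rightarrow> 'g"
    and bracket :: "'g \<Rightarrow> 'g \<Rightarrow> 'g"
    and Basis :: "'g set"
  assumes "lie_algebra scale bracket"
    and "finite_dimensional_vector_space scale Basis"
    and "\<not> lie_abelian bracket"
  shows "ce_cocycle (semidirect_scale scale) (semidirect_bracket bracket)
           (semidirect_scale scale) (semidirect_bracket bracket)
           2 (semidirect_cochain bracket) \<and>
         \<not> ce_coboundary (semidirect_scale scale) (semidirect_bracket bracket)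
           (semidirect_scale scale) (semidirect_bracket bracket)
           2 (semidirect_cochain bracket)"
  using assms lie_algebra.ce_cocycle_semidirect_cochain
    lie_algebra.lie_abelian_if_semidirect_cochain_coboundary
  by blast

end
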